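(* Let $N\in[1,\infty)$ and let $(M,d,\mu)$ be a noncompact $\mathrm{CD}^\ast(0,N)$ space. Then $\mu(M)=\infty$, and moreover, for every $o\in M$, there exists a positive constant $C$ such that $$\liminf_{r\to\infty}\frac{\mu(B(o,r))}{r}>C.$$
   Context: **Metric measure spaces.** $(M,d)$ is a complete separable metric space and $\mu$ is a non-negative Radon measure on $M$ with full topological support; $B(x,r)$ is the ball of center $x$ and radius $r$. Write $e_t(\gamma)=\gamma_t$ for $\gamma\in C([0,1],M)$. **$\mathrm{CD}^\ast(0,N)$, $N\in[1,\infty)$.** $(M,d,\mu)$ is a $\mathrm{CD}^\ast(0,N)$ space if for every pair $\eta_i=\rho_i\mu$ ($i=0,1$) of Borel probability measures with bounded support there is an optimal dynamical plan $\pi$ (a Borel probability measure on constant speed geodesics $\gamma:[0,1]\to M$ such that $(e_0,e_1)_\#\pi$ is an optimal coupling of $\eta_0,\eta_1$ for the cost $d^2$) such that, for all $t\in[0,1]$ and $N'\ge N$, $$\int_M\rho_t^{1-1/N'}\,d\mu\ \ge\ \int\big[(1-t)\rho_0^{-1/N'}(\gamma_0)+t\,\rho_1^{-1/N'}(\gamma_1)\big]\,d\pi(\gamma),$$ where $\rho_t$ is the density of $(e_t)_\#\pi$ with respect to $\mu$. *)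

theory Defs
  imports "HOL-Probability.Probability"
begin

section \<open>Borel measures on metric spaces\<close>

definition borel_of_topology :: "'b topology \<Rightarrow> 'b measure"
  where "borel_of_topology X = sigma (topspace X) {U. openin X U}"

definition radon_measure :: "'a::metric_space measure \<Rightarrow> bool"
  where "radon_measure \<mu> \<longleftrightarrow>
    sets \<mu> = sets borel \<and>
    (\<forall>x. \<exists>U. open U \<and> x \<in> U \<and> emeasure \<mu> U < \<infinity>) \<and>
    (\<forall>A\<in>sets borel. emeasure \<mu> A = (SUP K\<in>{K. compact K \<and> K \<subseteq> A}. emeasure \<mu> K))"

definition supp_measure :: "'a::metric_space measure \<Rightarrow> 'a set"
  where "supp_measure \<eta> = {x. \<forall>U. open U \<longrightarrow> x \<in> U \<longrightarrow> emeasure \<eta> U > 0}"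

definition metric_measure_space :: "'a::polish_space measure \<Rightarrow> bool"
  where "metric_measure_space \<mu> \<longleftrightarrow> radon_measure \<mu> \<and> supp_measure \<mu> = UNIV"


section \<open>Optimal couplings and optimal dynamical plans\<close>

definition coupling ::
    "'a::polish_space measure \<Rightarrow> 'a measure \<Rightarrow> ('a \<times> 'a) measure \<Rightarrow> bool"
  where "coupling \<eta>0 \<eta>1 q \<longleftrightarrow>
    sets q = sets borel \<and> prob_space q \<and> distr q borel fst = \<eta>0 \<and> distr q borel snd = \<eta>1"

definition transport_cost :: "('a::polish_space \<times> 'a) measure \<Rightarrow> ennreal"
  where "transport_cost q = (\<integral>\<^sup>+ (x, y). ennreal ((dist x y)\<^sup>2) \<partial>q)"

definition optimal_coupling ::
    "'a::polish_space measure \<Rightarrow> 'a measure \<Rightarrow> ('a \<times> 'a) measure \<Rightarrow> bool"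
  where "optimal_coupling \<eta>0 \<eta>1 q \<longleftrightarrow>
    coupling \<eta>0 \<eta>1 q \<and> (\<forall>q'. coupling \<eta>0 \<eta>1 q' \<longrightarrow> transport_cost q \<le> transport_cost q')"

text \<open>
  The space \<open>C([0,1],M)\<close> with the uniform distance. Its elements are functions on \<open>real\<close> that
  are undefined outside the unit interval (\<^const>\<open>extensional\<close>).
\<close>

definition path_metric :: "(real \<Rightarrow> 'a::metric_space) metric"
  where "path_metric = cfunspace (top_of_set {0..1}) euclidean_metric"

definition geodesics :: "(real \<Rightarrow> 'a::metric_space) set"
  where "geodesics = {\<gamma> \<in> mspace path_metric.
    \<forall>s\<in>{0..1}. \<forall>t\<in>{0..1}. dist (\<gamma> s) (\<gamma> t) = \<bar>s - t\<bar> * dist (\<gamma> 0) (\<gamma> 1)}"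

definition geodesic_topology :: "(real \<Rightarrow> 'a::metric_space) topology"
  where "geodesic_topology = subtopology (mtopology_of path_metric) geodesics"

definition optimal_dynamical_plan ::
    "'a::polish_space measure \<Rightarrow> 'a measure \<Rightarrow> (real \<Rightarrow> 'a) measure \<Rightarrow> bool"
  where "optimal_dynamical_plan \<eta>0 \<eta>1 \<pi> \<longleftrightarrow>
    sets \<pi> = sets (borel_of_topology geodesic_topology) \<and> prob_space \<pi> \<and>
    optimal_coupling \<eta>0 \<eta>1 (distr \<pi> borel (\<lambda>\<gamma>. (\<gamma> 0, \<gamma> 1)))"

text \<open>
  The library's \<^const>\<open>distr\<close> is the pushforward only along measurable maps. The evaluation maps
  below are continuous, so this is harmless.
\<close>

lemma space_borel_of_topology: "space (borel_of_topology X) = topspace X"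
  unfolding borel_of_topology_def by (intro space_measure_of) (auto dest: openin_subset)

lemma topspace_geodesic_topology: "topspace geodesic_topology = geodesics"
  unfolding geodesic_topology_def geodesics_def by auto

lemma borel_of_topology_measurable:
  assumes "continuous_map X euclidean f"
  shows "f \<in> measurable (borel_of_topology X) borel"
proof (rule borel_measurableI)
  fix S :: "'b set" assume "open S"
  then have "openin X {x \<in> topspace X. f x \<in> S}"
    using assms by (simp add: continuous_map)
  then show "f -` S \<inter> space (borel_of_topology X) \<in> sets (borel_of_topology X)"
    unfolding space_borel_of_topology unfolding borel_of_topology_def
    by (subst sets_measure_of)
      (auto simp: vimage_def Collect_conj_eq Int_commute dest: openin_subset)
qed

lemma continuous_map_evaluation:
  assumes "t \<in> {0..1}"
  shows "continuous_map (mtopology_of path_metric) euclidean (\<lambda>\<gamma> :: real \<Rightarrow> 'a::metric_space. \<gamma> t)"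
proof -
  have "Lipschitz_continuous_map path_metric euclidean_metric (\<lambda>\<gamma> :: real \<Rightarrow> 'a. \<gamma> t)"
    unfolding Lipschitz_continuous_map_def
  proof (intro conjI exI[of _ 1] ballI)
    fix x y :: "real \<Rightarrow> 'a"
    assume "x \<in> mspace path_metric" "y \<in> mspace path_metric"
    then show "mdist euclidean_metric (x t) (y t) \<le> 1 * mdist path_metric x y"
      using mdist_cfunspace_imp_mdist_le[of x "top_of_set {0..1}" euclidean_metric y _ t] assms
      unfolding path_metric_def by simp
  qed auto
  from Lipschitz_continuous_imp_continuous_map[OF this] show ?thesis
    by simp
qed

lemma measurable_evaluation:
  assumes "t \<in> {0..1}"
  shows "(\<lambda>\<gamma>. \<gamma> t) \<in> measurable (borel_of_topology geodesic_topology) borel"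
  unfolding geodesic_topology_def
  by (intro borel_of_topology_measurable continuous_map_from_subtopology
      continuous_map_evaluation assms)

lemma measurable_endpoints:
  "(\<lambda>\<gamma>. (\<gamma> 0, \<gamma> 1 :: 'a::polish_space)) \<in>
    measurable (borel_of_topology geodesic_topology) borel"
  by (intro borel_measurable_Pair measurable_evaluation) auto


section \<open>The reduced curvature-dimension condition for curvature bound zero\<close>

definition prob_density :: "'a::polish_space measure \<Rightarrow> ('a \<Rightarrow> real) \<Rightarrow> bool"
  where "prob_density \<mu> \<rho> \<longleftrightarrow>
    \<rho> \<in> borel_measurable borel \<and> (\<forall>x. 0 \<le> \<rho> x) \<and> prob_space (density \<mu> \<rho>)"

text \<open>
  The integrals are Lebesgue integrals of nonnegative functions with values in \<open>[0,\<infinity>]\<close>.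
  Since \<open>0 powr a = 0\<close> for every \<open>a\<close>, the left-hand integrand vanishes off \<open>{\<rho> t > 0}\<close>, also
  when \<open>N' = 1\<close>: the integral is then \<open>\<mu> {\<rho> t > 0}\<close>, the usual convention for the Renyi entropy.
  The value of \<open>\<rho>0 powr (-1/N')\<close> where \<open>\<rho>0\<close> vanishes is immaterial, because \<open>\<rho>0 (\<gamma> 0) > 0\<close> for
  \<open>\<pi>\<close>-almost every \<open>\<gamma>\<close>; likewise for \<open>\<rho>1\<close>.
\<close>

definition CD_star_0 :: "real \<Rightarrow> 'a::polish_space measure \<Rightarrow> bool"
  where "CD_star_0 N \<mu> \<longleftrightarrow> metric_measure_space \<mu> \<and>
    (\<forall>\<rho>0 \<rho>1. prob_density \<mu> \<rho>0 \<longrightarrow> bounded (supp_measure (density \<mu> \<rho>0)) \<longrightarrow>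
       prob_density \<mu> \<rho>1 \<longrightarrow> bounded (supp_measure (density \<mu> \<rho>1)) \<longrightarrow>
       (\<exists>\<pi> \<rho>. optimal_dynamical_plan (density \<mu> \<rho>0) (density \<mu> \<rho>1) \<pi> \<and>
         (\<forall>t\<in>{0..1}. prob_density \<mu> (\<rho> t) \<and> distr \<pi> borel (\<lambda>\<gamma>. \<gamma> t) = density \<mu> (\<rho> t) \<and>
           (\<forall>N'\<ge>N.
             (\<integral>\<^sup>+ x. ennreal (\<rho> t x powr (1 - 1 / N')) \<partial>\<mu>) \<ge>
             (\<integral>\<^sup>+ \<gamma>. ennreal ((1 - t) * \<rho>0 (\<gamma> 0) powr (- 1 / N') + t * \<rho>1 (\<gamma> 1) powr (- 1 / N')) \<partial>\<pi>)))))"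

end

theory Submission
  imports Defs
begin

text \<open>
  By the Brunn--Minkowski inequality, a set containing all the time-\<open>t\<close> points of geodesics from
  \<open>A0\<close> to \<open>A1\<close> has measure at least \<open>t\<^sup>N \<mu>(A1)\<close>, however small \<open>A0\<close> is. If \<open>M\<close> is
  unbounded, transport a small ball around a point \<open>x\<close> with \<open>d(p,x) \<ge> 8k\<close> to a small ball
  around \<open>p\<close>: at time \<open>1 - 4k/d(p,x) \<ge> 1/2\<close> all geodesics lie in the annulus
  \<open>4k - 2 < d(p,\<cdot>) < 4k + 2\<close>. Hence all these disjoint annuli have measure bounded below by the
  same constant. If \<open>M\<close> is bounded and \<open>\<mu>(M)\<close> finite, the same inequality with \<open>A1 = M\<close> and
  small \<open>t\<close> bounds the measure of balls of a given radius from below, so \<open>M\<close> is totally bounded.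
\<close>

section \<open>Uniform distributions on sets of positive finite measure\<close>

definition uniform_density :: "'a::polish_space measure \<Rightarrow> 'a set \<Rightarrow> 'a \<Rightarrow> real"
  where "uniform_density \<mu> A x = indicator A x / measure \<mu> A"

lemma uniform_density_on: "x \<in> A \<Longrightarrow> uniform_density \<mu> A x = 1 / measure \<mu> A"
  by (simp add: uniform_density_def)

lemma measure_pos_of_emeasure:
  assumes "0 < emeasure \<mu> A" "emeasure \<mu> A < \<infinity>"
  shows "0 < measure \<mu> A" "emeasure \<mu> A = ennreal (measure \<mu> A)"
proof -
  show eq: "emeasure \<mu> A = ennreal (measure \<mu> A)"
    using assms(2) by (intro emeasure_eq_ennreal_measure) auto
  show "0 < measure \<mu> A"
    using assms(1) by (simp add: eq)
qed

lemma emeasure_density_uniform_density: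
  assumes "sets \<mu> = sets borel" "A \<in> sets borel" "B \<in> sets borel"
  shows "emeasure (density \<mu> (uniform_density \<mu> A)) B
    = ennreal (1 / measure \<mu> A) * emeasure \<mu> (A \<inter> B)"
proof -
  have [measurable_cong]: "sets \<mu> = sets borel" by fact
  note assms(2,3)[measurable]
  have [measurable]: "uniform_density \<mu> A \<in> borel_measurable borel"
    unfolding uniform_density_def by measurable
  have "emeasure (density \<mu> (uniform_density \<mu> A)) B
      = (\<integral>\<^sup>+ x. ennreal (uniform_density \<mu> A x) * indicator B x \<partial>\<mu>)"
    by (intro emeasure_density) measurable
  also have "\<dots> = (\<integral>\<^sup>+ x. ennreal (1 / measure \<mu> A) * indicator (A \<inter> B) x \<partial>\<mu>)"
    by (intro nn_integral_cong) (auto simp: uniform_density_def indicator_def)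
  also have "\<dots> = ennreal (1 / measure \<mu> A) * emeasure \<mu> (A \<inter> B)"
    by (intro nn_integral_cmult_indicator) measurable
  finally show ?thesis .
qed

lemma prob_density_uniform_density:
  assumes "sets \<mu> = sets borel" "A \<in> sets borel" "0 < emeasure \<mu> A" "emeasure \<mu> A < \<infinity>"
  shows "prob_density \<mu> (uniform_density \<mu> A)"
  unfolding prob_density_def
proof (intro conjI)
  show "uniform_density \<mu> A \<in> borel_measurable borel"
    using assms(2) unfolding uniform_density_def by measurable
  show "\<forall>x. 0 \<le> uniform_density \<mu> A x"
    by (simp add: uniform_density_def)
  have "space \<mu> = UNIV"
    using sets_eq_imp_space_eq[OF assms(1)] by simp
  then have "emeasure (density \<mu> (uniform_density \<mu> A)) (space (density \<mu> (uniform_density \<mu> A)))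
      = ennreal (1 / measure \<mu> A) * ennreal (measure \<mu> A)"
    using emeasure_density_uniform_density[OF assms(1,2), of UNIV]
      measure_pos_of_emeasure(2)[OF assms(3,4)] by simp
  also have "\<dots> = 1"
    using measure_pos_of_emeasure(1)[OF assms(3,4)] by (simp flip: ennreal_mult)
  finally show "prob_space (density \<mu> (uniform_density \<mu> A))"
    by (rule prob_spaceI)
qed

text \<open>The complement of \<open>closure A\<close> is open and null for the uniform
  distribution, so it misses the support. This supplies the bounded-support premise of
  \<open>CD_star_0\<close>.\<close>

lemma bounded_supp_uniform_density:
  assumes "sets \<mu> = sets borel" "A \<in> sets borel" "bounded A"
  shows "bounded (supp_measure (density \<mu> (uniform_density \<mu> A)))"
proof (rule bounded_subset[OF bounded_closure[OF assms(3)]], rule subsetI, rule ccontr)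
  fix x assume x: "x \<in> supp_measure (density \<mu> (uniform_density \<mu> A))" "x \<notin> closure A"
  have "A \<inter> - closure A = {}"
    using closure_subset by auto
  then have "emeasure (density \<mu> (uniform_density \<mu> A)) (- closure A) = 0"
    by (subst emeasure_density_uniform_density[OF assms(1,2)]) auto
  with x show False
    unfolding supp_measure_def by (auto dest!: spec[of _ "- closure A"])
qed

lemma AE_uniform_density:
  assumes "sets \<mu> = sets borel" "A \<in> sets borel"
  shows "AE x in density \<mu> (uniform_density \<mu> A). x \<in> A"
proof (rule AE_I)
  show "{x \<in> space (density \<mu> (uniform_density \<mu> A)). x \<notin> A} \<subseteq> - A" by auto
  show "emeasure (density \<mu> (uniform_density \<mu> A)) (- A) = 0"
    by (subst emeasure_density_uniform_density[OF assms]) (use assms in auto)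
  show "- A \<in> sets (density \<mu> (uniform_density \<mu> A))"
    using assms by simp
qed

section \<open>Renyi entropy bounds and the Brunn--Minkowski inequality\<close>

text \<open>Weighted AM-GM with weights \<open>1 - 1 / N\<close> and \<open>1 / N\<close>, that is,
  convexity of \<open>exp\<close> between \<open>ln a\<close> and \<open>ln s\<close>.\<close>

lemma young_powr:
  fixes a s N :: real
  assumes "0 \<le> a" "0 < s" "1 \<le> N"
  shows "a powr (1 - 1 / N) * s powr (1 / N) \<le> (1 - 1 / N) * a + s / N"
\<comment> \<open>The logarithmic form needs \<open>a > 0\<close>. At \<open>a = 0\<close> the left
  side vanishes, even for \<open>N = 1\<close>, because \<open>0 powr 0 = 0\<close>.\<close>
proof (cases "a = 0")
  case True
  then show ?thesis using assms by simp
next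
  case False
  then have "a powr (1 - 1 / N) * s powr (1 / N) = exp ((1 - 1 / N) * ln a + (1 / N) * ln s)"
    using assms by (simp add: powr_def exp_add)
  also have "\<dots> \<le> (1 - 1 / N) * exp (ln a) + (1 / N) * exp (ln s)"
    using convex_onD[OF exp_convex, of "1 / N" "ln a" "ln s"] assms by simp
  also have "\<dots> = (1 - 1 / N) * a + s / N"
    using assms False by simp
  finally show ?thesis .
qed

text \<open>Jensen's inequality for the concave power \<open>1 - 1 / N\<close>: the uniform density
  on \<open>Z\<close> is extremal. Instead of Jensen, a pointwise linear bound is integrated, which
  also covers \<open>N = 1\<close>.\<close>

lemma nn_integral_powr_le_of_prob_density:
  fixes \<mu> :: "'a::polish_space measure"
  assumes "sets \<mu> = sets borel" "prob_density \<mu> \<rho>" "Z \<in> sets borel" "1 \<le> N"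
    and conc: "AE x in density \<mu> \<rho>. x \<in> Z"
    and fin: "emeasure \<mu> Z < \<infinity>"
  shows "(\<integral>\<^sup>+ x. ennreal (\<rho> x powr (1 - 1 / N)) \<partial>\<mu>) \<le> ennreal (measure \<mu> Z powr (1 / N))"
proof -
  have [measurable_cong]: "sets \<mu> = sets borel" by fact
  note assms(3)[measurable]
  have [measurable]: "\<rho> \<in> borel_measurable borel" and nonneg: "\<And>x. 0 \<le> \<rho> x"
    and prob: "prob_space (density \<mu> \<rho>)"
    using assms(2) by (auto simp: prob_density_def)
  have total: "(\<integral>\<^sup>+ x. ennreal (\<rho> x) \<partial>\<mu>) = 1"
    using prob_space.emeasure_space_1[OF prob] by (subst (asm) emeasure_density) (auto cong: nn_integral_cong)
  have zero: "AE x in \<mu>. x \<notin> Z \<longrightarrow> \<rho> x = 0"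
    using conc by (subst (asm) AE_density) (auto elim!: eventually_mono simp: less_le nonneg)
  let ?m = "measure \<mu> Z"
  have m: "emeasure \<mu> Z = ennreal ?m"
    using fin by (intro emeasure_eq_ennreal_measure) auto
  \<comment> \<open>If \<open>Z\<close> were null, \<open>\<rho>\<close> would vanish almost
    everywhere and could not have total mass 1.\<close>
  have "?m \<noteq> 0"
  proof
    assume "?m = 0"
    then have "AE x in \<mu>. x \<notin> Z"
      using m by (intro AE_not_in) (auto simp: null_sets_def assms(1,3))
    then have "AE x in \<mu>. ennreal (\<rho> x) = 0"
      using zero by eventually_elim auto
    then have "(\<integral>\<^sup>+ x. ennreal (\<rho> x) \<partial>\<mu>) = 0"
      by (subst nn_integral_0_iff_AE) auto
    with total show False by simp
  qed
  then have mpos: "0 < ?m" by (simp add: less_le)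
  \<comment> \<open>Young's inequality with \<open>s = 1 / ?m\<close>, the value of the uniform
    density on \<open>Z\<close>: the right side is the tangent line of the power at that
    value.\<close>
  have le: "\<rho> x powr (1 - 1 / N) \<le> ?m powr (1 / N) * ((1 - 1 / N) * \<rho> x + (1 / ?m) / N)" for x
    using young_powr[OF nonneg[of x], of "1 / ?m" N] mpos assms(4)
    by (simp add: powr_divide field_simps)
  have "(\<integral>\<^sup>+ x. ennreal (\<rho> x powr (1 - 1 / N)) \<partial>\<mu>)
      \<le> (\<integral>\<^sup>+ x. ennreal (?m powr (1 / N)) *
            (ennreal (1 - 1 / N) * ennreal (\<rho> x) + ennreal (1 / ?m / N) * indicator Z x) \<partial>\<mu>)"
  proof (rule nn_integral_mono_AE, use zero in eventually_elim)
    case (elim x)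
    show ?case
    proof (cases "x \<in> Z")
      case True
      then show ?thesis
        using le[of x] assms(4) nonneg[of x] mpos
        by (simp flip: ennreal_mult ennreal_plus add: ennreal_leI)
    qed (use elim in simp)
  qed
  also have "\<dots> = ennreal (?m powr (1 / N)) *
      (ennreal (1 - 1 / N) * 1 + ennreal (1 / ?m / N) * ennreal ?m)"
    by (simp add: nn_integral_cmult nn_integral_add total m)
  \<comment> \<open>The total mass 1 of \<open>\<rho>\<close> and the measure \<open>?m\<close> of
    \<open>Z\<close> turn the linear bound back into the two weights, which sum to 1.\<close>
  also have "ennreal (1 - 1 / N) * 1 + ennreal (1 / ?m / N) * ennreal ?m = ennreal 1"
    using assms(4) mpos by (simp flip: ennreal_mult ennreal_plus del: ennreal_1)
  finally show ?thesis by simp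
qed

text \<open>
  The transport between the uniform distributions on \<open>A0\<close> and \<open>A1\<close> is at time \<open>t\<close> concentrated
  on \<open>Z\<close>, which bounds its Renyi entropy by the measure of \<open>Z\<close>. The contribution of \<open>A0\<close> is
  dropped.
\<close>

lemma CD_star_0_brunn_minkowski:
  fixes \<mu> :: "'a::polish_space measure"
  assumes N: "1 \<le> N" and CD: "CD_star_0 N \<mu>"
    and A0: "open A0" "bounded A0" "0 < emeasure \<mu> A0" "emeasure \<mu> A0 < \<infinity>"
    and A1: "open A1" "bounded A1" "0 < emeasure \<mu> A1" "emeasure \<mu> A1 < \<infinity>"
    and t: "t \<in> {0..1}" and Z: "open Z"
    and geo: "\<And>\<gamma>. \<gamma> \<in> geodesics \<Longrightarrow> \<gamma> 0 \<in> A0 \<Longrightarrow> \<gamma> 1 \<in> A1 \<Longrightarrow> \<gamma> t \<in> Z"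
  shows "ennreal (t powr N) * emeasure \<mu> A1 \<le> emeasure \<mu> Z"
proof (cases "emeasure \<mu> Z < \<infinity>")
  case fin: True
  have sets_\<mu>: "sets \<mu> = sets borel"
    using CD by (simp add: CD_star_0_def metric_measure_space_def radon_measure_def)
  note m1 = measure_pos_of_emeasure[OF A1(3,4)]
  let ?r0 = "uniform_density \<mu> A0" and ?r1 = "uniform_density \<mu> A1"
  have borel_A: "A0 \<in> sets borel" "A1 \<in> sets borel"
    using A0(1) A1(1) by auto
  note dens0 = prob_density_uniform_density[OF sets_\<mu> borel_A(1) A0(3,4)]
    and dens1 = prob_density_uniform_density[OF sets_\<mu> borel_A(2) A1(3,4)]
    and supp0 = bounded_supp_uniform_density[OF sets_\<mu> borel_A(1) A0(2)]
    and supp1 = bounded_supp_uniform_density[OF sets_\<mu> borel_A(2) A1(2)]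
  obtain \<pi> \<rho> where plan: "optimal_dynamical_plan (density \<mu> ?r0) (density \<mu> ?r1) \<pi>"
    and interp: "\<forall>t\<in>{0..1}. prob_density \<mu> (\<rho> t) \<and> distr \<pi> borel (\<lambda>\<gamma>. \<gamma> t) = density \<mu> (\<rho> t) \<and>
      (\<forall>N'\<ge>N.
        (\<integral>\<^sup>+ x. ennreal (\<rho> t x powr (1 - 1 / N')) \<partial>\<mu>) \<ge>
        (\<integral>\<^sup>+ \<gamma>. ennreal ((1 - t) * ?r0 (\<gamma> 0) powr (- 1 / N') + t * ?r1 (\<gamma> 1) powr (- 1 / N')) \<partial>\<pi>))"
    using CD[unfolded CD_star_0_def, THEN conjunct2, THEN spec, THEN spec, THEN mp, THEN mp,
        THEN mp, THEN mp, OF dens0 supp0 dens1 supp1] by (elim exE conjE)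
  note interp_t = bspec[OF interp t]
  have \<rho>: "prob_density \<mu> (\<rho> t)" "distr \<pi> borel (\<lambda>\<gamma>. \<gamma> t) = density \<mu> (\<rho> t)"
    using interp_t by simp_all
  have entropy: "(\<integral>\<^sup>+ \<gamma>. ennreal ((1 - t) * ?r0 (\<gamma> 0) powr (- 1 / N) + t * ?r1 (\<gamma> 1) powr (- 1 / N)) \<partial>\<pi>)
      \<le> (\<integral>\<^sup>+ x. ennreal (\<rho> t x powr (1 - 1 / N)) \<partial>\<mu>)"
    using interp_t[THEN conjunct2, THEN conjunct2, THEN spec, of N] by simp
  have sets_\<pi>: "sets \<pi> = sets (borel_of_topology geodesic_topology)" and "prob_space \<pi>"
    and marg: "distr (distr \<pi> borel (\<lambda>\<gamma>. (\<gamma> 0, \<gamma> 1))) borel fst = density \<mu> ?r0"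
      "distr (distr \<pi> borel (\<lambda>\<gamma>. (\<gamma> 0, \<gamma> 1))) borel snd = density \<mu> ?r1"
    using plan unfolding optimal_dynamical_plan_def optimal_coupling_def coupling_def by auto
  interpret prob_space \<pi> by fact
  have space_\<pi>: "space \<pi> = geodesics"
    using sets_eq_imp_space_eq[OF sets_\<pi>] space_borel_of_topology topspace_geodesic_topology by metis
  have ev: "(\<lambda>\<gamma>. \<gamma> s) \<in> measurable \<pi> borel" if "s \<in> {0..1}" for s
    using measurable_evaluation[OF that] measurable_cong_sets[OF sets_\<pi> refl] by blast
  have pair: "(\<lambda>\<gamma>. (\<gamma> 0, \<gamma> 1)) \<in> measurable \<pi> borel"
    using measurable_endpoints measurable_cong_sets[OF sets_\<pi> refl] by blast
  have fst_snd: "fst \<in> borel_measurable (borel :: ('a \<times> 'a) measure)"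
    "snd \<in> borel_measurable (borel :: ('a \<times> 'a) measure)"
    by (auto intro!: borel_measurable_continuous_onI continuous_intros)
  have d0: "distr \<pi> borel (\<lambda>\<gamma>. \<gamma> 0) = density \<mu> ?r0" and d1: "distr \<pi> borel (\<lambda>\<gamma>. \<gamma> 1) = density \<mu> ?r1"
    using marg fst_snd pair by (simp_all add: distr_distr comp_def)
  have "AE \<gamma> in \<pi>. \<gamma> 0 \<in> A0"
    using AE_uniform_density[OF sets_\<mu> borel_A(1), folded d0] ev[of 0] borel_A
    by (subst (asm) AE_distr_iff) auto
  moreover have AE1: "AE \<gamma> in \<pi>. \<gamma> 1 \<in> A1"
    using AE_uniform_density[OF sets_\<mu> borel_A(2), folded d1] ev[of 1] borel_A
    by (subst (asm) AE_distr_iff) auto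
  \<comment> \<open>\<open>AE_space\<close> is what makes almost every \<open>\<gamma>\<close> a
    geodesic, as \<open>geo\<close> demands.\<close>
  ultimately have "AE \<gamma> in \<pi>. \<gamma> t \<in> Z"
    using AE_space by eventually_elim (auto simp: space_\<pi> intro: geo)
  then have "AE x in density \<mu> (\<rho> t). x \<in> Z"
    using ev[OF t] Z by (subst \<rho>(2)[symmetric], subst AE_distr_iff) auto
  from nn_integral_powr_le_of_prob_density[OF sets_\<mu> \<rho>(1) _ N this fin]
  have upper: "(\<integral>\<^sup>+ x. ennreal (\<rho> t x powr (1 - 1 / N)) \<partial>\<mu>) \<le> ennreal (measure \<mu> Z powr (1 / N))"
    using Z by simp
  \<comment> \<open>Since \<open>\<pi>\<close> is a probability measure, the constant equals its
    integral. It bounds the entropy integrand from below wherever \<open>\<gamma> 1\<close> lies in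
    \<open>A1\<close>, where the density is \<open>1 / measure \<mu> A1\<close>.\<close>
  have "ennreal (t * measure \<mu> A1 powr (1 / N)) = (\<integral>\<^sup>+ \<gamma>. ennreal (t * measure \<mu> A1 powr (1 / N)) \<partial>\<pi>)"
    by (simp add: emeasure_space_1)
  also have "\<dots> \<le> (\<integral>\<^sup>+ \<gamma>. ennreal ((1 - t) * ?r0 (\<gamma> 0) powr (- 1 / N) + t * ?r1 (\<gamma> 1) powr (- 1 / N)) \<partial>\<pi>)"
  proof (rule nn_integral_mono_AE, use AE1 in eventually_elim)
    case (elim \<gamma>)
    have "?r1 (\<gamma> 1) powr (- 1 / N) = measure \<mu> A1 powr (1 / N)"
      using m1(1) by (simp add: uniform_density_on[OF elim] powr_minus powr_divide)
    then show ?case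
      using t by (intro ennreal_leI) simp
  qed
  finally have "ennreal (t * measure \<mu> A1 powr (1 / N)) \<le> ennreal (measure \<mu> Z powr (1 / N))"
    using entropy upper by (meson order_trans)
  \<comment> \<open>Raising to the power \<open>N\<close> removes the exponents \<open>1 / N\<close>
    and produces the factor \<open>t powr N\<close>.\<close>
  then have "(t * measure \<mu> A1 powr (1 / N)) powr N \<le> (measure \<mu> Z powr (1 / N)) powr N"
    using t N by (intro powr_mono2) (auto simp: ennreal_le_iff)
  then have "t powr N * measure \<mu> A1 \<le> measure \<mu> Z"
    using t N m1(1) by (simp add: powr_mult powr_powr)
  moreover have "emeasure \<mu> Z = ennreal (measure \<mu> Z)"
    using fin by (intro emeasure_eq_ennreal_measure) auto
  ultimately show ?thesis
    using m1 by (simp flip: ennreal_mult add: ennreal_leI)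
qed (auto simp: less_top[symmetric])

section \<open>Small balls, separated sets and sums over disjoint sets\<close>

text \<open>Finiteness comes from local finiteness, positivity from full support. The cap 1 on the
  radius controls the position errors in the annulus estimate.\<close>

lemma metric_measure_space_small_ball:
  assumes "metric_measure_space \<mu>"
  obtains \<delta> where "0 < \<delta>" "\<delta> \<le> 1" "0 < emeasure \<mu> (ball p \<delta>)" "emeasure \<mu> (ball p \<delta>) < \<infinity>"
proof -
  have sets_\<mu>: "sets \<mu> = sets borel"
    using assms by (simp add: metric_measure_space_def radon_measure_def)
  obtain U where U: "open U" "p \<in> U" "emeasure \<mu> U < \<infinity>"
    using assms unfolding metric_measure_space_def radon_measure_def by blast
  obtain e where e: "0 < e" "ball p e \<subseteq> U"
    using U(1,2) openE by blast
  let ?\<delta> = "min e 1"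
  have "emeasure \<mu> (ball p ?\<delta>) \<le> emeasure \<mu> U"
    using e U(1) sets_\<mu> by (intro emeasure_mono) auto
  moreover have "p \<in> supp_measure \<mu>"
    using assms by (simp add: metric_measure_space_def)
  then have "0 < emeasure \<mu> (ball p ?\<delta>)"
    using e(1) by (simp add: supp_measure_def)
  ultimately show thesis
    using e(1) U(3) by (intro that[of ?\<delta>]) auto
qed

lemma geodesics_dist:
  assumes "\<gamma> \<in> geodesics" "s \<in> {0..1}" "t \<in> {0..1}"
  shows "dist (\<gamma> s) (\<gamma> t) = \<bar>s - t\<bar> * dist (\<gamma> 0) (\<gamma> 1)"
  using assms unfolding geodesics_def by blast

text \<open>Greedy choice: finitely many \<open>\<epsilon>\<close>-balls never cover, so a separated
  set can always be enlarged by a point outside the balls around its members.\<close>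

lemma exists_separated_set:
  fixes \<epsilon> :: real
  assumes "0 < \<epsilon>" and "\<And>k. finite k \<Longrightarrow> \<not> UNIV \<subseteq> (\<Union>x\<in>k. ball (x::'a::metric_space) \<epsilon>)"
  shows "\<exists>k::'a set. finite k \<and> card k = n \<and> pairwise (\<lambda>x y. \<epsilon> \<le> dist x y) k"
proof (induction n)
  case 0
  show ?case by (intro exI[of _ "{}"]) auto
next
  case (Suc n)
  then obtain k :: "'a set" where k: "finite k" "card k = n" "pairwise (\<lambda>x y. \<epsilon> \<le> dist x y) k"
    by blast
  obtain y where y: "\<forall>x\<in>k. \<epsilon> \<le> dist x y"
    using assms(2)[OF k(1)] by (force simp: not_less)
  then have "y \<notin> k"
    using assms(1) by auto
  then show ?case
    using k y by (intro exI[of _ "insert y k"]) (auto simp: pairwise_insert dist_commute)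
qed

lemma card_mult_le_emeasure:
  assumes "finite I" "disjoint_family_on A I" "B \<in> sets \<mu>"
    and "\<And>i. i \<in> I \<Longrightarrow> A i \<in> sets \<mu> \<and> A i \<subseteq> B \<and> c \<le> emeasure \<mu> (A i)"
  shows "of_nat (card I) * c \<le> emeasure \<mu> B"
proof -
  have "of_nat (card I) * c \<le> (\<Sum>i\<in>I. emeasure \<mu> (A i))"
    using assms(4) by (intro sum_bounded_below) auto
  also have "\<dots> = emeasure \<mu> (\<Union>i\<in>I. A i)"
    using assms by (intro sum_emeasure) auto
  also have "\<dots> \<le> emeasure \<mu> B"
    using assms by (intro emeasure_mono) auto
  finally show ?thesis .
qed

lemma eq_top_if_multiples_le:
  fixes x c :: ennreal
  assumes "0 < c" "\<And>n::nat. of_nat n * c \<le> x"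
  shows "x = \<infinity>"
proof (rule ccontr)
  assume "x \<noteq> \<infinity>"
  then obtain y where y: "x = ennreal y" "0 \<le> y"
    by (cases x) auto
  have "c \<noteq> top"
    using assms(2)[of 1] y by (auto simp: top_unique)
  then obtain z where z: "c = ennreal z" "0 < z"
    using assms(1) by (cases c) auto
  obtain n :: nat where "y < real n * z"
    using reals_Archimedean3[OF z(2)] by blast
  moreover have "ennreal (real n * z) \<le> ennreal y"
    using assms(2)[of n] y z by (simp add: ennreal_mult ennreal_of_nat_eq_real_of_nat)
  ultimately show False
    using y(2) by (simp add: ennreal_le_iff)
qed

section \<open>Bounded spaces of finite measure\<close>

text \<open>A complete space that is not compact fails to be totally bounded at some scale
  \<open>\<epsilon>\<close>. It then contains arbitrarily many disjoint balls of radius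
  \<open>\<epsilon> / 2\<close>, whose measures have a common positive lower bound, against
  finiteness.\<close>

lemma CD_star_0_compact_if_bounded_finite:
  fixes \<mu> :: "'a::polish_space measure"
  assumes N: "1 \<le> N" and CD: "CD_star_0 N \<mu>"
    and bdd: "bounded (UNIV :: 'a set)" and fin: "emeasure \<mu> UNIV < \<infinity>"
  shows "compact (UNIV :: 'a set)"
proof (rule ccontr)
  assume "\<not> compact (UNIV :: 'a set)"
  then obtain \<epsilon> :: real where \<epsilon>: "0 < \<epsilon>"
    "\<And>k. finite k \<Longrightarrow> \<not> UNIV \<subseteq> (\<Union>x\<in>k. ball (x::'a) \<epsilon>)"
    unfolding compact_eq_totally_bounded using complete_UNIV by blast
  have mms: "metric_measure_space \<mu>" and sets_\<mu>: "sets \<mu> = sets borel"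
    using CD by (auto simp: CD_star_0_def metric_measure_space_def radon_measure_def)
  have pos: "0 < emeasure \<mu> U" if "open U" "x \<in> U" for U and x :: 'a
    using mms that by (auto simp: metric_measure_space_def supp_measure_def)
  have fin': "emeasure \<mu> U < \<infinity>" for U
    using fin emeasure_space[of \<mu> U] sets_eq_imp_space_eq[OF sets_\<mu>] by simp
  obtain D where D: "\<And>x y :: 'a. dist x y \<le> D"
    using bdd by (auto simp: bounded_two_points)
  then have "0 \<le> D"
    by (metis dist_self)
  \<comment> \<open>A geodesic has length at most \<open>D\<close>, so by time \<open>t\<close> it
    has moved less than \<open>\<epsilon> / 4\<close>. The term \<open>4 * \<epsilon>\<close> keeps
    the denominator positive when \<open>D = 0\<close> and the estimate strict.\<close>
  define t where "t = \<epsilon> / (4 * D + 4 * \<epsilon>)"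
  have t: "0 < t" "t \<le> 1" "t * D < \<epsilon> / 4"
    using \<epsilon>(1) \<open>0 \<le> D\<close> by (auto simp: t_def field_simps add_pos_nonneg)
  define c where "c = ennreal (t powr N) * emeasure \<mu> UNIV"
  have "0 < c"
    using t(1) pos[of UNIV] by (simp add: c_def ennreal_zero_less_mult_iff)
  \<comment> \<open>Starting within \<open>\<epsilon> / 4\<close> of \<open>x\<close> and moving
    less than \<open>\<epsilon> / 4\<close> ends within \<open>\<epsilon> / 2\<close>. The target
    set is the whole space, so \<open>c\<close> does not depend on \<open>x\<close>.\<close>
  have lower: "c \<le> emeasure \<mu> (ball x (\<epsilon> / 2))" for x
    unfolding c_def
  proof (rule CD_star_0_brunn_minkowski[OF N CD, of "ball x (\<epsilon> / 4)"])
    fix \<gamma> :: "real \<Rightarrow> 'a"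
    assume \<gamma>: "\<gamma> \<in> geodesics" "\<gamma> 0 \<in> ball x (\<epsilon> / 4)"
    have "dist (\<gamma> 0) (\<gamma> t) = t * dist (\<gamma> 0) (\<gamma> 1)"
      using geodesics_dist[OF \<gamma>(1), of 0 t] t by simp
    also have "\<dots> \<le> t * D"
      using t D by (intro mult_left_mono) auto
    also have "\<dots> < \<epsilon> / 4"
      by (rule t)
    finally show "\<gamma> t \<in> ball x (\<epsilon> / 2)"
      using \<gamma>(2) dist_triangle[of x "\<gamma> t" "\<gamma> 0"] by simp
  qed (use \<epsilon>(1) t bdd fin' pos[of _ x] in auto)
  have "of_nat n * c \<le> emeasure \<mu> UNIV" for n
  proof -
    obtain k :: "'a set" where k: "finite k" "card k = n" "pairwise (\<lambda>x y. \<epsilon> \<le> dist x y) k"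
      using exists_separated_set[OF \<epsilon>] by blast
    have "disjoint_family_on (\<lambda>x. ball x (\<epsilon> / 2)) k"
      unfolding disjoint_family_on_def
    proof (intro ballI impI)
      fix x y assume "x \<in> k" "y \<in> k" "x \<noteq> y"
      then have "\<epsilon> \<le> dist x y"
        using k(3) by (auto simp: pairwise_def)
      then show "ball x (\<epsilon> / 2) \<inter> ball y (\<epsilon> / 2) = {}"
        by (intro disjoint_ballI) simp
    qed
    then show ?thesis
      using card_mult_le_emeasure[OF k(1), of "\<lambda>x. ball x (\<epsilon> / 2)" UNIV \<mu> c] k(2) lower sets_\<mu>
      by simp
  qed
  with \<open>0 < c\<close> fin show False
    using eq_top_if_multiples_le by fastforce
qed

section \<open>Unbounded spaces: annuli and linear growth\<close>

text \<open>The ball around \<open>p\<close> is the target of the transport because the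
  Brunn--Minkowski bound involves only the target's measure. The bound is therefore uniform in
  \<open>k\<close>, although the remote starting ball depends on \<open>k\<close>.\<close>

lemma CD_star_0_annulus:
  fixes \<mu> :: "'a::polish_space measure" and k :: nat
  assumes N: "1 \<le> N" and CD: "CD_star_0 N \<mu>" and unbdd: "\<not> bounded (UNIV :: 'a set)"
    and \<delta>: "0 < \<delta>" "\<delta> \<le> 1" "0 < emeasure \<mu> (ball p \<delta>)" "emeasure \<mu> (ball p \<delta>) < \<infinity>"
  shows "ennreal ((1 / 2) powr N) * emeasure \<mu> (ball p \<delta>)
    \<le> emeasure \<mu> {y. 4 * real k - 2 < dist p y \<and> dist p y < 4 * real k + 2}"
proof -
  have mms: "metric_measure_space \<mu>"
    using CD by (simp add: CD_star_0_def)
  \<comment> \<open>The distance \<open>8 * real k\<close> gives \<open>s \<le> 1 / 2\<close> below;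
    the extra 1 keeps \<open>d\<close> positive when \<open>k = 0\<close>.\<close>
  obtain x where x: "8 * real k + 1 < dist p x"
    using unbdd unfolding bounded_any_center[of _ p] by (auto simp: not_le)
  obtain \<delta>' where \<delta>': "0 < \<delta>'" "\<delta>' \<le> 1" "0 < emeasure \<mu> (ball x \<delta>')" "emeasure \<mu> (ball x \<delta>') < \<infinity>"
    using metric_measure_space_small_ball[OF mms] by blast
  define d where "d = dist p x"
  have d: "8 * real k \<le> d" "0 < d"
    using x by (auto simp: d_def)
  \<comment> \<open>\<open>s\<close> is the fraction of the way from \<open>p\<close> to
    \<open>x\<close> at which the distance from \<open>p\<close> is \<open>4 * real k\<close>. As
    the transport runs towards \<open>p\<close>, the time used is \<open>1 - s\<close>.\<close>
  define s where "s = 4 * real k / d"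
  have s: "0 \<le> s" "s \<le> 1 / 2" "s * d = 4 * real k"
    using d by (auto simp: s_def field_simps)
  let ?A = "{y. 4 * real k - 2 < dist p y \<and> dist p y < 4 * real k + 2}"
  have "ennreal ((1 / 2) powr N) * emeasure \<mu> (ball p \<delta>) \<le> ennreal ((1 - s) powr N) * emeasure \<mu> (ball p \<delta>)"
    using s N by (intro mult_right_mono ennreal_leI powr_mono2) auto
  also have "\<dots> \<le> emeasure \<mu> ?A"
  proof (rule CD_star_0_brunn_minkowski[OF N CD, of "ball x \<delta>'"])
    show "open ?A"
      by (intro open_Collect_conj open_Collect_less continuous_intros)
    fix \<gamma> :: "real \<Rightarrow> 'a"
    assume \<gamma>: "\<gamma> \<in> geodesics" "\<gamma> 0 \<in> ball x \<delta>'" "\<gamma> 1 \<in> ball p \<delta>"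
    let ?L = "dist (\<gamma> 0) (\<gamma> 1)"
    have near: "dist x (\<gamma> 0) < 1" "dist p (\<gamma> 1) < 1"
      using \<gamma>(2,3) \<delta>(2) \<delta>'(2) by auto
    \<comment> \<open>Each endpoint is off by less than 1, so the length is off by at most 2. The
      factor \<open>s \<le> 1 / 2\<close> reduces this to an error of at most 1.\<close>
    have "\<bar>?L - d\<bar> \<le> 2"
      unfolding d_def using near by metric
    then have "s * \<bar>?L - d\<bar> \<le> 1 / 2 * 2"
      using s by (intro mult_mono) auto
    then have "\<bar>s * (?L - d)\<bar> \<le> 1"
      using s by (simp add: abs_mult)
    then have "\<bar>s * ?L - 4 * real k\<bar> \<le> 1"
      using s by (simp add: right_diff_distrib)
    moreover have "dist (\<gamma> (1 - s)) (\<gamma> 1) = s * ?L"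
      using geodesics_dist[OF \<gamma>(1), of "1 - s" 1] s by simp
    \<comment> \<open>Replacing the endpoint \<open>\<gamma> 1\<close> by \<open>p\<close> costs
      strictly less than 1, so the total error is strictly below 2, the half-width of the
      annulus.\<close>
    moreover have "\<bar>dist p (\<gamma> (1 - s)) - dist (\<gamma> (1 - s)) (\<gamma> 1)\<bar> < 1"
      using near(2) dist_triangle[of p "\<gamma> (1 - s)" "\<gamma> 1"] dist_triangle[of "\<gamma> (1 - s)" "\<gamma> 1" p]
      by (simp add: dist_commute abs_less_iff)
    ultimately show "\<gamma> (1 - s) \<in> ?A"
      by auto
  qed (use \<delta> \<delta>' s in auto)
  finally show ?thesis .
qed

text \<open>The first \<open>n\<close> annuli are disjoint and fit in the ball of radius
  \<open>4 * real n + 2\<close>, so their common lower bound is counted \<open>n\<close>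
  times.\<close>

lemma CD_star_0_ball_linear:
  fixes \<mu> :: "'a::polish_space measure"
  assumes N: "1 \<le> N" and CD: "CD_star_0 N \<mu>" and unbdd: "\<not> bounded (UNIV :: 'a set)"
  obtains c where "0 < c" "\<And>n r. 4 * real n + 2 \<le> r \<Longrightarrow> of_nat n * ennreal c \<le> emeasure \<mu> (ball p r)"
proof -
  have mms: "metric_measure_space \<mu>" and sets_\<mu>: "sets \<mu> = sets borel"
    using CD by (auto simp: CD_star_0_def metric_measure_space_def radon_measure_def)
  obtain \<delta> where \<delta>: "0 < \<delta>" "\<delta> \<le> 1" "0 < emeasure \<mu> (ball p \<delta>)" "emeasure \<mu> (ball p \<delta>) < \<infinity>"
    using metric_measure_space_small_ball[OF mms] by blast
  note m = measure_pos_of_emeasure[OF \<delta>(3,4)]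
  define c where "c = (1 / 2) powr N * measure \<mu> (ball p \<delta>)"
  let ?A = "\<lambda>k::nat. {y. 4 * real k - 2 < dist p y \<and> dist p y < 4 * real k + 2}"
  have lower: "ennreal c \<le> emeasure \<mu> (?A k)" for k
    using CD_star_0_annulus[OF N CD unbdd \<delta>, of k] unfolding m(2)
    by (simp add: c_def ennreal_mult)
  have disj: "disjoint_family_on ?A {1..n}" for n
    unfolding disjoint_family_on_def
  proof (intro ballI impI)
    fix i j :: nat assume "i \<noteq> j"
    \<comment> \<open>The mean radii of distinct annuli are at least 4 apart, which is twice the
      half-width; the strict inequalities exclude a common boundary.\<close>
    then have "real i + 1 \<le> real j \<or> real j + 1 \<le> real i"
      by linarith
    then show "?A i \<inter> ?A j = {}"
      by auto
  qed
  have open_A: "open (?A k)" for k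
    by (intro open_Collect_conj open_Collect_less continuous_intros)
  show thesis
  proof (rule that[of c])
    show "0 < c"
      using m(1) by (simp add: c_def)
    fix n r assume r: "4 * real n + 2 \<le> r"
    have "of_nat (card {1..n}) * ennreal c \<le> emeasure \<mu> (ball p r)"
    proof (rule card_mult_le_emeasure[OF _ disj])
      fix k assume "k \<in> {1..n}"
      then have "real k \<le> real n" by simp
      then show "?A k \<in> sets \<mu> \<and> ?A k \<subseteq> ball p r \<and> ennreal c \<le> emeasure \<mu> (?A k)"
        using r lower open_A[of k] sets_\<mu> by auto
    qed (auto simp: sets_\<mu>)
    then show "of_nat n * ennreal c \<le> emeasure \<mu> (ball p r)"
      by simp
  qed
qed

theorem lemma3p8:
  fixes \<mu> :: "'a::polish_space measure" and N :: real
  assumes "1 \<le> N"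
    and "CD_star_0 N \<mu>"
    and "\<not> compact (UNIV :: 'a set)"
  shows "emeasure \<mu> UNIV = \<infinity> \<and>
    (\<forall>p::'a. \<exists>C::real. 0 < C \<and>
      Liminf at_top (\<lambda>r::real. emeasure \<mu> (ball p r) / ennreal r) > ennreal C)"
proof (cases "bounded (UNIV :: 'a set)")
  \<comment> \<open>A bounded space need not be compact here. In this case the measure is infinite
    and large balls are the whole space, so the quotient is eventually infinite and
    \<open>C = 1\<close> works.\<close>
  case True
  have top: "emeasure \<mu> UNIV = \<infinity>"
    using CD_star_0_compact_if_bounded_finite[OF assms(1,2) True] assms(3)
    by (auto simp: less_top[symmetric])
  have "ennreal 1 < Liminf at_top (\<lambda>r::real. emeasure \<mu> (ball p r) / ennreal r)" for p :: 'a
  proof -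
    obtain D where D: "\<And>x :: 'a. dist p x \<le> D"
      using True unfolding bounded_any_center[of _ p] by auto
    have "eventually (\<lambda>r. (\<infinity>::ennreal) \<le> emeasure \<mu> (ball p r) / ennreal r) at_top"
      using eventually_gt_at_top[of D]
    proof eventually_elim
      case (elim r)
      then have "ball p r = UNIV"
        using le_less_trans[OF D elim] by auto
      then show ?case
        using top by (simp add: ennreal_top_divide)
    qed
    then have "(\<infinity>::ennreal) \<le> Liminf at_top (\<lambda>r::real. emeasure \<mu> (ball p r) / ennreal r)"
      by (rule Liminf_bounded)
    then show ?thesis
      by (simp add: top_unique)
  qed
  then show ?thesis
    using top zero_less_one by blast
next
  case False
  note linear = CD_star_0_ball_linear[OF assms(1,2) False]
  have "\<exists>C::real. 0 < C \<and> Liminf at_top (\<lambda>r::real. emeasure \<mu> (ball p r) / ennreal r) > ennreal C"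
    for p :: 'a
  proof -
    obtain c where c: "0 < c" "\<And>n r. 4 * real n + 2 \<le> r \<Longrightarrow> of_nat n * ennreal c \<le> emeasure \<mu> (ball p r)"
      using linear[of p] by blast
    have "eventually (\<lambda>r. ennreal (c / 8) \<le> emeasure \<mu> (ball p r) / ennreal r) at_top"
      \<comment> \<open>From 12 on, \<open>(r - 2) / 4 - 1 \<ge> r / 8\<close>, so the rounding
        below still leaves \<open>real n \<ge> r / 8\<close>.\<close>
      using eventually_ge_at_top[of 12]
    proof eventually_elim
      case (elim r)
      \<comment> \<open>The largest number of annuli that are guaranteed to fit in the ball of
        radius \<open>r\<close>.\<close>
      define n where "n = nat \<lfloor>(r - 2) / 4\<rfloor>"
      have "real n = of_int \<lfloor>(r - 2) / 4\<rfloor>"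
        using elim by (simp add: n_def)
      then have n: "real n \<le> (r - 2) / 4" "(r - 2) / 4 - 1 < real n"
        using of_int_floor_le[of "(r - 2) / 4"] real_of_int_floor_gt_diff_one[of "(r - 2) / 4"]
        by simp_all
      have "4 * real n + 2 \<le> r"
        using n(1) by (simp add: field_simps)
      have "r / 8 \<le> real n"
        using n(2) elim by (simp add: field_simps)
      have "ennreal (c / 8) = ennreal (r / 8 * c) / ennreal r"
        using elim c(1) by (simp add: divide_ennreal)
      also have "\<dots> \<le> (of_nat n * ennreal c) / ennreal r"
        using \<open>r / 8 \<le> real n\<close> c(1) elim
        by (intro divide_right_mono_ennreal) (simp add: ennreal_of_nat_eq_real_of_nat ennreal_leI flip: ennreal_mult)
      also have "\<dots> \<le> emeasure \<mu> (ball p r) / ennreal r"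
        by (intro divide_right_mono_ennreal c) fact
      finally show ?case .
    qed
    then have "ennreal (c / 8) \<le> Liminf at_top (\<lambda>r::real. emeasure \<mu> (ball p r) / ennreal r)"
      by (rule Liminf_bounded)
    \<comment> \<open>The limit inferior is only known to be at least \<open>c / 8\<close>; halving
      the constant makes the inequality strict.\<close>
    moreover have "ennreal (c / 16) < ennreal (c / 8)"
      using c(1) by (intro ennreal_lessI) auto
    ultimately show ?thesis
      using c(1) by (intro exI[of _ "c / 16"]) auto
  qed
  moreover have "emeasure \<mu> UNIV = \<infinity>"
  proof -
    fix p :: 'a
    obtain c where c: "0 < c" "\<And>n r. 4 * real n + 2 \<le> r \<Longrightarrow> of_nat n * ennreal c \<le> emeasure \<mu> (ball p r)"
      using linear[of p] by blast
    have "space \<mu> = UNIV"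
      using assms(2) sets_eq_imp_space_eq[of \<mu> borel]
      by (simp add: CD_star_0_def metric_measure_space_def radon_measure_def)
    then have "of_nat n * ennreal c \<le> emeasure \<mu> UNIV" for n
      using c(2)[of n "4 * real n + 2"] emeasure_space[of \<mu> "ball p (4 * real n + 2)"] by simp
    then show ?thesis
      using c(1) eq_top_if_multiples_le[of "ennreal c"] by simp
  qed
  ultimately show ?thesis by blast
qed

end
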